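(* Let $t_{i-1}<t_i$, let $\xi(i-1,j),\xi(i,j)\in\mathbb R^2$, let $Q=Q^T\succ0$ and $R=R^T\succ0$ be $2\times2$ real matrices, and let $\gamma_i^j(t)$, $t\in[t_{i-1},t_i]$, denote the reparameterized reference path $\gamma_i^j(p_j(t))$ described in the context, which satisfies $\gamma_i^j(t_{i-1})=\xi(i-1,j)$ and $\gamma_i^j(t_i)=\xi(i,j)$. Consider the problem of minimizing $$J(u_j)=\frac12\int_{t_{i-1}}^{t_i}\left(x_j-\gamma_i^j\right)^TQ\left(x_j-\gamma_i^j\right)+u_j^TRu_j\,\mathrm d\tau$$ subject to $\dot x_j=u_j$, $x_j(t)\in\mathbb R^2$, $x_j(t_{i-1})=\xi(i-1,j)$ and $x_j(t_i)=\xi(i,j)$. Let $H,K,G,E,D$ be the solutions on $[t_{i-1},t_i]$ of the terminal value problems $$\begin{aligned}\dot H&=HR^{-1}H-Q,& H(t_i)&=0_{2\times2},\\ \dot K&=HR^{-1}K,& K(t_i)&=I_2,\\ \dot G&=K^TR^{-1}K,& G(t_i)&=0_{2\times2},\\ \dot E&=HR^{-1}E+Q\gamma_i^j,& E(t_i)&=0_{2\times1},\\ \dot D&=K^TR^{-1}E,& D(t_i)&=0_{2\times1}.\end{aligned}$$ Then the tracking controller $$u_j^*(x_j,t)=-R^{-1}\Big[H(t)x_j(t)+K(t)G^{-1}(t_{i-1})\Big(\xi(i,j)-K^T(t_{i-1})\xi(i-1,j)-D(t_{i-1})\Big)+E(t)\Big]$$ is a minimizer of $J$, and the optimal value is $$J(u_j^*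 )=\Big[\xi(i-1,j)^T\left(\tfrac12H-KG^{-1}K^T\right)\xi(i-1,j)+\xi(i-1,j)^T\left(KG^{-1}\left(\xi(i,j)-D\right)+E\right)+\varphi\Big]\Big|_{t=t_{i-1}},$$ where $\varphi(t)$ is the solution of the terminal value problem $$\dot\varphi=\tfrac12\Lambda_j(t)^TR^{-1}\Lambda_j(t)-\tfrac12\gamma_i^j(t)^TQ\gamma_i^j(t),\qquad \varphi(t_i)=-\xi(i,j)^T\Lambda_j(t_i),$$ with $$\Lambda_j(t)=E(t)+K(t)G^{-1}(t_{i-1})\left(\xi(i,j)-K^T(t_{i-1})\xi(i-1,j)-D(t_{i-1})\right).$$
   Context: The indices $i$ (braid step) and $j$ (agent) are fixed. The minimization is over square-integrable controls $u_j:[t_{i-1},t_i]\to\mathbb R^2$ for which the state trajectory meets both endpoint constraints. The reference path is a curve $\gamma_i^j:[0,1]\to\mathbb R^2$ of arclength $\Delta=\int_0^1\|\dot\gamma_i^j(p)\|\,\mathrm dp>0$ (regular enough for the arclength to be defined; in particular continuous) with $\gamma_i^j(0)=\xi(i-1,j)$ and $\gamma_i^j(1)=\xi(i,j)$. It is traversed as $t\mapsto\gamma_i^j(p_j(t))$, where $p_j:[t_{i-1},t_i]\to[0,1]$ is continuous and piecewise linear with $p_j(t_{i-1})=0$ and, with $\bar t_i=\frac{t_{i-1}+t_i}2$ and a constant $\delta\in[0,\Delta]$, $$p_j(t)=\begin{cases}\dfrac{t-t_{i-1}}{t_i-t_{i-1}}\dfrac{\Delta\pm\delta}{\Delta},&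 t\in(t_{i-1},\bar t_i],\\[2mm] \dfrac{t-\bar t_i}{t_i-t_{i-1}}\dfrac{\Delta\mp\delta}{\Delta}+\dfrac{\Delta\pm\delta}{2\Delta},& t\in(\bar t_i,t_i],\end{cases}$$ with either all upper signs or all lower signs. In the cost, in the differential equations for $E$ and $\varphi$, and wherever $\gamma_i^j$ is evaluated at time $t$, $\gamma_i^j(t)$ abbreviates $\gamma_i^j(p_j(t))$. $0_{m\times n}$ is the $m\times n$ zero matrix, $I_2$ the $2\times2$ identity, and $\succ0$ means positive definite. *)

theory Defs
  imports "HOL-Analysis.Analysis"
begin

definition sym_pos_def :: "real^'n^'n \<Rightarrow> bool" where
  "sym_pos_def A \<longleftrightarrow> transpose A = A \<and> (\<forall>v. v \<noteq> 0 \<longrightarrow> v \<bullet> (A *v v) > 0)"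


text \<open>
  Regularity of the reference curve: continuous on \<open>[0,1]\<close>, differentiable almost everywhere, with
  integrable speed. This is what is needed for the integral of the speed to make sense; every
  absolutely continuous (in particular every piecewise \<open>C\<^sup>1\<close>) curve qualifies. The value of
  \<^const>\<open>vector_derivative\<close> at the exceptional points is irrelevant, as they form a null set.
\<close>

definition regular_curve :: "(real \<Rightarrow> 'a::euclidean_space) \<Rightarrow> bool" where
  "regular_curve \<gamma> \<longleftrightarrow>
     continuous_on {0..1} \<gamma> \<and>
     (\<exists>N. negligible N \<and> (\<forall>p\<in>{0..1} - N. \<gamma> differentiable (at p within {0..1}))) \<and>
     (\<lambda>p. norm (vector_derivative \<gamma> (at p within {0..1}))) integrable_on {0..1}"

definition arclength :: "(real \<Rightarrow> 'a::euclidean_space) \<Rightarrow> real" where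
  "arclength \<gamma> = integral {0..1} (\<lambda>p. norm (vector_derivative \<gamma> (at p within {0..1})))"


text \<open>
  The piecewise linear time parameterization \<open>p\<close> of the curve over \<open>[a,b]\<close>, where \<open>L\<close> is the
  arclength. The sign \<open>s\<close> is \<open>1\<close> for the upper and \<open>-1\<close> for the lower choice of all
  the signs. The first formula also gives the prescribed value \<open>0\<close> at \<open>t = a\<close>.
\<close>

definition traversal :: "real \<Rightarrow> real \<Rightarrow> real \<Rightarrow> real \<Rightarrow> real \<Rightarrow> real \<Rightarrow> real" where
  "traversal a b L \<delta> s t =
     (if t \<le> (a + b) / 2
      then (t - a) / (b - a) * ((L + s * \<delta>) / L)
      else (t - (a + b) / 2) / (b - a) * ((L - s * \<delta>) / L) + (L + s * \<delta>) / (2 * L))"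

lemma traversal_endpoints:
  assumes "a < b" "L > 0"
  shows "traversal a b L \<delta> s a = 0" and "traversal a b L \<delta> s b = 1"
proof -
  have half: "(b - (a + b) / 2) / (b - a) = 1 / 2"
    using assms by (simp add: field_simps)
  have "\<not> b \<le> (a + b) / 2"
    using assms by simp
  then have "traversal a b L \<delta> s b = 1 / 2 * ((L - s * \<delta>) / L) + (L + s * \<delta>) / (2 * L)"
    by (simp only: traversal_def half if_False)
  also have "\<dots> = 1"
    using assms by (simp add: field_simps)
  finally show "traversal a b L \<delta> s b = 1" .
qed (use assms in \<open>simp add: traversal_def\<close>)


definition square_integrable :: "real \<Rightarrow> real \<Rightarrow> (real \<Rightarrow> 'a::euclidean_space) \<Rightarrow> bool" where
  "square_integrable a b u \<longleftrightarrow>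
     set_borel_measurable lebesgue {a..b} u \<and>
     set_integrable lebesgue {a..b} (\<lambda>t. (norm (u t))\<^sup>2)"

text \<open>
  The state trajectory of a control on \<open>[a,b]\<close>, i.e. the absolutely continuous (Caratheodory)
  solution of \<open>x' = u\<close>, \<open>x(a) = x0\<close>.
\<close>

definition trajectory :: "real \<Rightarrow> 'a::euclidean_space \<Rightarrow> (real \<Rightarrow> 'a) \<Rightarrow> real \<Rightarrow> 'a" where
  "trajectory a x0 u t = x0 + (LINT \<tau>:{a..t}|lebesgue. u \<tau>)"

definition admissible_control ::
    "real \<Rightarrow> real \<Rightarrow> 'a::euclidean_space \<Rightarrow> 'a \<Rightarrow> (real \<Rightarrow> 'a) \<Rightarrow> bool" where
  "admissible_control a b x0 x1 u \<longleftrightarrow> square_integrable a b u \<and> trajectory a x0 u b = x1"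

definition tracking_cost ::
    "real \<Rightarrow> real \<Rightarrow> real^'n \<Rightarrow> (real \<Rightarrow> real^'n) \<Rightarrow> real^'n^'n \<Rightarrow> real^'n^'n
      \<Rightarrow> (real \<Rightarrow> real^'n) \<Rightarrow> real" where
  "tracking_cost a b x0 r Q R u =
     1/2 * (LINT \<tau>:{a..b}|lebesgue.
              (trajectory a x0 u \<tau> - r \<tau>) \<bullet> (Q *v (trajectory a x0 u \<tau> - r \<tau>))
              + u \<tau> \<bullet> (R *v u \<tau>))"

definition is_minimizer_on :: "('a \<Rightarrow> real) \<Rightarrow> 'a set \<Rightarrow> 'a \<Rightarrow> bool" where
  "is_minimizer_on J U u \<longleftrightarrow> u \<in> U \<and> (\<forall>v\<in>U. J u \<le> J v)"

definition solves_on ::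
    "(real \<Rightarrow> 'a::real_normed_vector) \<Rightarrow> (real \<Rightarrow> 'a \<Rightarrow> 'a) \<Rightarrow> real \<Rightarrow> real \<Rightarrow> bool" where
  "solves_on x f a b \<longleftrightarrow>
     (\<forall>t\<in>{a..b}. (x has_vector_derivative f t (x t)) (at t within {a..b}))"

end

theory Submission
  imports Defs
begin

text \<open>Existence: \<open>K\<close> is a fundamental solution of \<open>y' = H R\<^sup>-\<^sup>1 y\<close>, hence invertible, and
  \<open>K\<^sup>T x + D + G \<nu>\<close> is conserved along the closed loop. Inverting \<open>K\<^sup>T\<close> therefore solves the closed
  loop explicitly, and the choice of \<open>\<nu>\<close> makes the conserved quantity, which is \<open>x t1\<close> at the
  final time, equal to \<open>\<xi>1\<close>.

  Optimality: along the closed loop the costate \<open>p = R u = - (H x + \<Lambda>)\<close> satisfies \<open>p' = Q (x - r)\<close>,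
  and since the cost is convex, an integration by parts against an arbitrary square-integrable
  variation suffices. The optimal value comes from the quadratic value function with coefficients
  \<open>H\<close>, \<open>\<Lambda>\<close>, \<open>\<phi>\<close>.\<close>

subsection \<open>Matrix calculus\<close>

text \<open>Bounded bilinearity of the matrix products yields product rules, continuity and, via
  \<open>pos_bounded\<close>, the norm estimates behind the uniqueness arguments.\<close>

lemma bounded_bilinear_matrix_vector_mult:
  "bounded_bilinear ((*v) :: real^'n^'m \<Rightarrow> real^'n \<Rightarrow> real^'m)"
  unfolding bilinear_conv_bounded_bilinear[symmetric] bilinear_def
  by (auto intro!: linearI simp: matrix_vector_mult_add_rdistrib scaleR_matrix_vector_assoc[symmetric]
      matrix_vector_right_distrib matrix_vector_mult_scaleR)

lemma bounded_bilinear_matrix_mult: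
  "bounded_bilinear ((**) :: real^'n^'m \<Rightarrow> real^'k^'n \<Rightarrow> real^'k^'m)"
  unfolding bilinear_conv_bounded_bilinear[symmetric] bilinear_def
  by (auto intro!: linearI simp: matrix_add_ldistrib matrix_matrix_mult_def vec_eq_iff
      scaleR_sum_right sum.distrib sum_distrib_left algebra_simps)

lemma bounded_linear_transpose: "bounded_linear (transpose :: real^'n^'m \<Rightarrow> real^'m^'n)"
  unfolding linear_conv_bounded_linear[symmetric]
  by (auto intro!: linearI simp: transpose_def vec_eq_iff)

lemmas has_vector_derivative_matrix_vector_mult =
  bounded_bilinear.has_vector_derivative[OF bounded_bilinear_matrix_vector_mult]
lemmas has_vector_derivative_transpose =
  bounded_linear.has_vector_derivative[OF bounded_linear_transpose]
lemmas has_vector_derivative_inner =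
  bounded_bilinear.has_vector_derivative[OF bounded_bilinear_inner]

lemmas continuous_on_matrix_vector_mult =
  bounded_bilinear.continuous_on[OF bounded_bilinear_matrix_vector_mult]
lemmas continuous_on_matrix_mult =
  bounded_bilinear.continuous_on[OF bounded_bilinear_matrix_mult]
lemmas continuous_on_transpose =
  bounded_linear.continuous_on[OF bounded_linear_transpose]

lemma inner_matrix_vector_transpose:
  fixes A :: "real^'n^'m"
  shows "x \<bullet> (A *v y) = (transpose A *v x) \<bullet> y"
  by (simp add: dot_lmul_matrix)

lemma solves_onD:
  "solves_on x f a b \<Longrightarrow> t \<in> {a..b} \<Longrightarrow> (x has_vector_derivative f t (x t)) (at t within {a..b})"
  by (simp add: solves_on_def)

lemma solves_on_continuous_on: "solves_on x f a b \<Longrightarrow> continuous_on {a..b} x"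
  unfolding solves_on_def
  by (meson continuous_on_eq_continuous_within has_vector_derivative_continuous)

section \<open>Positive definite matrices and inverses\<close>

lemma sym_pos_def_inner_nonneg: "sym_pos_def A \<Longrightarrow> 0 \<le> v \<bullet> (A *v v)"
  unfolding sym_pos_def_def by (cases "v = 0") (auto simp: less_imp_le)

lemma sym_pos_def_invertible:
  assumes "sym_pos_def (A :: real^'n^'n)"
  shows "invertible A"
proof -
  have "\<forall>x. A *v x = 0 \<longrightarrow> x = 0"
    using assms unfolding sym_pos_def_def by (metis inner_zero_right less_irrefl)
  then show ?thesis
    by (simp add: invertible_left_inverse matrix_left_invertible_ker)
qed

text \<open>\<open>matrix_inv\<close> is a choice among two-sided inverses, so it carries
  information only once an inverse is known to exist.\<close>

lemma matrix_inv_cancel: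
  assumes "invertible (A :: real^'n^'n)"
  shows "A ** matrix_inv A = mat 1" "matrix_inv A ** A = mat 1"
    "A *v (matrix_inv A *v v) = v" "matrix_inv A *v (A *v v) = v"
proof -
  show 1: "A ** matrix_inv A = mat 1" "matrix_inv A ** A = mat 1"
    using someI_ex[OF assms[unfolded invertible_def]] unfolding matrix_inv_def by auto
  show "A *v (matrix_inv A *v v) = v" "matrix_inv A *v (A *v v) = v"
    by (simp_all add: matrix_vector_mul_assoc 1)
qed

text \<open>Positivity is that of \<open>A\<close> after the substitution v = A w, with w the image
  of v under the inverse. This applies to the weight of the Gramian, which is the inverse of
  \<open>R\<close>.\<close>

lemma sym_pos_def_matrix_inv:
  assumes A: "sym_pos_def (A :: real^'n^'n)"
  shows "sym_pos_def (matrix_inv A)"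
proof -
  let ?M = "matrix_inv A"
  note inv = matrix_inv_cancel[OF sym_pos_def_invertible[OF A]]
  have "transpose ?M = transpose ?M ** (A ** ?M)"
    by (simp add: inv)
  also have "\<dots> = transpose (A ** ?M) ** ?M"
    using A by (simp add: sym_pos_def_def matrix_transpose_mul matrix_mul_assoc)
  also have "\<dots> = ?M"
    by (simp add: inv)
  finally have "transpose ?M = ?M" .
  moreover have "0 < v \<bullet> (?M *v v)" if "v \<noteq> 0" for v
  proof -
    have "?M *v v \<noteq> 0"
      using that inv(3)[of v] by auto
    then have "0 < (?M *v v) \<bullet> (A *v (?M *v v))"
      using A unfolding sym_pos_def_def by blast
    then show ?thesis
      by (simp only: inv(3) inner_commute)
  qed
  ultimately show ?thesis
    by (simp add: sym_pos_def_def)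
qed

subsection \<open>Linear and Riccati differential equations\<close>

text \<open>A Gronwall argument in both time directions: an exponential weight of rate 2C or -2C
  makes the squared norm monotone on the chosen side of \<open>c\<close>, where it is zero. The
  backward direction matters because the data are terminal values.\<close>

lemma zero_if_norm_derivative_le:
  fixes y :: "real \<Rightarrow> 'a::real_inner"
  assumes deriv: "\<And>t. t \<in> {a..b} \<Longrightarrow> (y has_vector_derivative y' t) (at t within {a..b})"
    and le: "\<And>t. t \<in> {a..b} \<Longrightarrow> norm (y' t) \<le> C * norm (y t)"
    and c: "c \<in> {a..b}" "y c = 0" and t: "t \<in> {a..b}"
  shows "y t = 0"
proof -
  define g where "g k t = exp (k * t) * (y t \<bullet> y t)" for k t
  define g' where "g' k t = exp (k * t) * (k * (y t \<bullet> y t) + 2 * (y t \<bullet> y' t))" for k t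
  have g: "(g k has_real_derivative g' k t) (at t within {a..b})" if "t \<in> {a..b}" for k t
  proof -
    have "((\<lambda>t. y t \<bullet> y t) has_real_derivative 2 * (y t \<bullet> y' t)) (at t within {a..b})"
      using has_vector_derivative_inner[OF deriv[OF that] deriv[OF that]]
      by (simp add: has_real_derivative_iff_has_vector_derivative inner_commute)
    then show ?thesis
      unfolding g_def g'_def
      by (auto intro!: derivative_eq_intros simp: algebra_simps)
  qed
  have bound: "\<bar>y t \<bullet> y' t\<bar> \<le> C * (y t \<bullet> y t)" if "t \<in> {a..b}" for t
  proof -
    have "\<bar>y t \<bullet> y' t\<bar> \<le> norm (y t) * norm (y' t)"
      by (rule Cauchy_Schwarz_ineq2)
    also have "\<dots> \<le> norm (y t) * (C * norm (y t))"
      by (rule mult_left_mono[OF le[OF that]]) simp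
    finally show ?thesis
      by (simp add: dot_square_norm power2_eq_square mult_ac)
  qed
  have cont: "continuous_on {a..b} (g k)" for k
    by (meson g continuous_on_eq_continuous_within has_field_derivative_subset DERIV_continuous)
  have at_interior: "(g k has_real_derivative g' k s) (at s)" if "a < s" "s < b" for k s
    using g[of s k] that by (simp add: at_within_Icc_at)
  have "y t \<bullet> y t \<le> 0"
  proof (cases "t \<le> c")
    case True
    \<comment> \<open>At rate 2C the derivative has the sign of 2C |y|^2 + 2 (y \<bullet> y'), which
      is nonnegative by \<open>bound\<close>.\<close>
    have "g (2 * C) t \<le> g (2 * C) c"
    proof (rule DERIV_nonneg_imp_increasing_open[OF True])
      fix s assume "t < s" "s < c"
      then show "\<exists>d. (g (2 * C) has_real_derivative d) (at s) \<and> 0 \<le> d"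
        using at_interior[of s "2 * C"] bound[of s] c t
        by (intro exI[of _ "g' (2 * C) s"]) (auto simp: g'_def)
    qed (rule continuous_on_subset[OF cont], use c t in auto)
    then show ?thesis
      using c by (simp add: g_def mult_le_0_iff)
  next
    case False
    then have "c \<le> t" by simp
    \<comment> \<open>At rate -2C the weighted square decreases; negating it allows the same
      monotonicity rule.\<close>
    have "- g (- 2 * C) c \<le> - g (- 2 * C) t"
    proof (rule DERIV_nonneg_imp_increasing_open[OF \<open>c \<le> t\<close>])
      fix s assume "c < s" "s < t"
      then show "\<exists>d. ((\<lambda>s. - g (- 2 * C) s) has_real_derivative d) (at s) \<and> 0 \<le> d"
        using at_interior[of s "- 2 * C"] bound[of s] c t
        by (intro exI[of _ "- g' (- 2 * C) s"])
          (auto intro!: derivative_eq_intros simp: g'_def mult_le_0_iff)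
    qed (intro continuous_intros continuous_on_subset[OF cont], use c t in auto)
    then show ?thesis
      using c by (simp add: g_def mult_le_0_iff)
  qed
  then show ?thesis
    by (metis inner_eq_zero_iff inner_ge_zero order_antisym)
qed

lemma continuous_on_Icc_norm_le:
  fixes f :: "real \<Rightarrow> 'a::real_normed_vector"
  assumes "continuous_on {a..b} f"
  obtains B where "0 \<le> B" "\<And>t. t \<in> {a..b} \<Longrightarrow> norm (f t) \<le> B"
proof -
  have "bounded (f ` {a..b})"
    by (intro compact_imp_bounded compact_continuous_image assms compact_Icc)
  then show ?thesis
    using that unfolding bounded_pos by (metis image_eqI less_imp_le)
qed

lemma solves_on_linear_zero:
  fixes A :: "real \<Rightarrow> real^'n^'n"
  assumes y: "solves_on y (\<lambda>t v. A t *v v) a b" and A: "continuous_on {a..b} A"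
    and c: "c \<in> {a..b}" "y c = 0" and t: "t \<in> {a..b}"
  shows "y t = 0"
proof -
  obtain C where C: "0 < C" "\<And>(X :: real^'n^'n) v. norm (X *v v) \<le> norm X * norm v * C"
    using bounded_bilinear.pos_bounded[OF bounded_bilinear_matrix_vector_mult] by blast
  obtain B where B: "0 \<le> B" "\<And>t. t \<in> {a..b} \<Longrightarrow> norm (A t) \<le> B"
    using continuous_on_Icc_norm_le[OF A] by blast
  show ?thesis
  proof (rule zero_if_norm_derivative_le)
    fix s assume s: "s \<in> {a..b}"
    show "(y has_vector_derivative A s *v y s) (at s within {a..b})"
      using y s by (simp add: solves_on_def)
    have "norm (A s) * norm (y s) * C \<le> B * norm (y s) * C"
      using B(2)[OF s] C by (intro mult_right_mono) auto
    then show "norm (A s *v y s) \<le> (B * C) * norm (y s)"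
      using C(2)[of "A s" "y s"] by (simp add: mult_ac)
  qed (fact c t)+
qed

text \<open>If v is in the kernel of \<open>X t\<close>, then \<open>X s *v v\<close> solves the
  vector equation and vanishes at \<open>t\<close>, hence also at \<open>c\<close>, where
  invertibility forces v = 0.\<close>

lemma solves_on_linear_invertible:
  fixes A X :: "real \<Rightarrow> real^'n^'n"
  assumes X: "solves_on X (\<lambda>t Y. A t ** Y) a b" and A: "continuous_on {a..b} A"
    and c: "c \<in> {a..b}" "invertible (X c)" and t: "t \<in> {a..b}"
  shows "invertible (X t)"
proof -
  have "v = 0" if v: "X t *v v = 0" for v
  proof -
    have "solves_on (\<lambda>s. X s *v v) (\<lambda>s w. A s *v w) a b"
      using X has_vector_derivative_matrix_vector_mult[OF _ has_vector_derivative_const[of v]]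
      unfolding solves_on_def by (fastforce simp: matrix_vector_mul_assoc)
    then have "X c *v v = 0"
      by (rule solves_on_linear_zero[OF _ A t]) (fact v c(1))+
    then show "v = 0"
      by (metis matrix_inv_cancel(4)[OF c(2)] matrix_vector_mult_0_right)
  qed
  then show ?thesis
    by (simp add: invertible_left_inverse matrix_left_invertible_ker)
qed

text \<open>Although the Riccati equation is nonlinear, the antisymmetric difference
  \<open>W\<close> obeys an equation linear in \<open>W\<close> with bounded coefficients, so it
  stays zero once it is zero at \<open>c\<close>.\<close>

lemma riccati_transpose_eq:
  fixes H :: "real \<Rightarrow> real^'n^'n" and M Q :: "real^'n^'n"
  assumes H: "solves_on H (\<lambda>t X. X ** M ** X - Q) a b"
    and sym: "transpose M = M" "transpose Q = Q"
    and c: "c \<in> {a..b}" "transpose (H c) = H c" and t: "t \<in> {a..b}"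
  shows "transpose (H t) = H t"
proof -
  define W where "W t = H t - transpose (H t)" for t
  obtain C where C: "0 < C" "\<And>(X :: real^'n^'n) Y :: real^'n^'n. norm (X ** Y) \<le> norm X * norm Y * C"
    using bounded_bilinear.pos_bounded[OF bounded_bilinear_matrix_mult] by blast
  have H_cont: "continuous_on {a..b} H"
    by (rule solves_on_continuous_on[OF H])
  obtain B1 where B1: "0 \<le> B1" "\<And>t. t \<in> {a..b} \<Longrightarrow> norm (M ** H t) \<le> B1"
    using continuous_on_Icc_norm_le[OF continuous_on_matrix_mult[OF continuous_on_const H_cont]]
    by blast
  obtain B2 where B2: "0 \<le> B2" "\<And>t. t \<in> {a..b} \<Longrightarrow> norm (transpose (H t) ** M) \<le> B2"
    using continuous_on_Icc_norm_le[OF continuous_on_matrix_mult[OF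
        continuous_on_transpose[OF H_cont] continuous_on_const]]
    by blast
  have "W t = 0"
  proof (rule zero_if_norm_derivative_le)
    fix s assume s: "s \<in> {a..b}"
    have dH: "(H has_vector_derivative H s ** M ** H s - Q) (at s within {a..b})"
      using H s by (simp add: solves_on_def)
    have "transpose (H s ** M ** H s - Q) = transpose (H s) ** M ** transpose (H s) - Q"
      using sym linear_diff[OF bounded_linear.linear[OF bounded_linear_transpose], of "H s ** M ** H s" Q]
      by (simp add: matrix_transpose_mul matrix_mul_assoc)
    \<comment> \<open>\<open>Q\<close> cancels by symmetry, and adding and subtracting H^T M H
      factors the rest through \<open>W\<close>.\<close>
    then have "(H s ** M ** H s - Q) - transpose (H s ** M ** H s - Q) =
        W s ** (M ** H s) + (transpose (H s) ** M) ** W s"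
      by (simp add: W_def bounded_bilinear.diff_left[OF bounded_bilinear_matrix_mult]
          bounded_bilinear.diff_right[OF bounded_bilinear_matrix_mult] matrix_mul_assoc)
    then show "(W has_vector_derivative W s ** (M ** H s) + (transpose (H s) ** M) ** W s) (at s within {a..b})"
      unfolding W_def[abs_def]
      using has_vector_derivative_diff[OF dH has_vector_derivative_transpose[OF dH]] by simp
    have "norm (W s) * norm (M ** H s) * C \<le> norm (W s) * B1 * C"
      using B1(2)[OF s] C(1) by (intro mult_right_mono mult_left_mono) auto
    with C(2)[of "W s" "M ** H s"] have "norm (W s ** (M ** H s)) \<le> norm (W s) * B1 * C"
      by linarith
    moreover have "norm (transpose (H s) ** M) * norm (W s) * C \<le> B2 * norm (W s) * C"
      using B2(2)[OF s] C(1) by (intro mult_right_mono) auto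
    with C(2)[of "transpose (H s) ** M" "W s"]
    have "norm ((transpose (H s) ** M) ** W s) \<le> B2 * norm (W s) * C"
      by linarith
    ultimately show "norm (W s ** (M ** H s) + (transpose (H s) ** M) ** W s) \<le> ((B1 + B2) * C) * norm (W s)"
      using norm_triangle_ineq[of "W s ** (M ** H s)" "(transpose (H s) ** M) ** W s"]
      by (simp add: algebra_simps)
  next
    show "W c = 0"
      by (simp add: W_def c)
  qed (fact c t)+
  then show ?thesis
    by (simp add: W_def)
qed

text \<open>\<open>G a\<close> is minus the integral of K^T M K. For v in its kernel the monotone
  function v \<bullet> G v is zero at both ends, hence constant, and its zero slope at
  \<open>b\<close> forces \<open>K b *v v = 0\<close> by positivity of \<open>M\<close>.\<close>

lemma gramian_invertible:
  fixes K G :: "real \<Rightarrow> real^'n^'n"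
  assumes "a < b" and M: "sym_pos_def M"
    and G: "solves_on G (\<lambda>t X. transpose (K t) ** M ** K t) a b" "G b = 0"
    and K: "invertible (K b)"
  shows "invertible (G a)"
proof -
  have "v = 0" if v: "G a *v v = 0" for v
  proof -
    define g where "g t = v \<bullet> (G t *v v)" for t
    have g: "(g has_real_derivative (K t *v v) \<bullet> (M *v (K t *v v))) (at t within {a..b})"
      if "t \<in> {a..b}" for t
    proof -
      have "(G has_vector_derivative transpose (K t) ** M ** K t) (at t within {a..b})"
        using G that by (simp add: solves_on_def)
      from has_vector_derivative_inner[OF has_vector_derivative_const
          has_vector_derivative_matrix_vector_mult[OF this has_vector_derivative_const], of v v]
      have "(g has_real_derivative v \<bullet> ((transpose (K t) ** M ** K t) *v v)) (at t within {a..b})"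
        by (simp add: g_def[abs_def] has_real_derivative_iff_has_vector_derivative)
      also have "v \<bullet> ((transpose (K t) ** M ** K t) *v v) = (K t *v v) \<bullet> (M *v (K t *v v))"
        by (simp add: inner_matrix_vector_transpose[of v "transpose (K t)"]
            matrix_vector_mul_assoc[symmetric] del: transpose_matrix_vector)
      finally show ?thesis .
    qed
    have cont: "continuous_on {a..b} g"
      by (meson g continuous_on_eq_continuous_within DERIV_continuous)
    have mono: "g s \<le> g t" if "a \<le> s" "s \<le> t" "t \<le> b" for s t
    proof (rule DERIV_nonneg_imp_increasing_open[OF \<open>s \<le> t\<close>])
      fix r assume "s < r" "r < t"
      then show "\<exists>y. (g has_real_derivative y) (at r) \<and> 0 \<le> y"
        using g[of r] that sym_pos_def_inner_nonneg[OF M] by (auto simp: at_within_Icc_at)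
    qed (use that in \<open>auto intro: continuous_on_subset[OF cont]\<close>)
    have "g t = 0" if "t \<in> {a..b}" for t
      using mono[of a t] mono[of t b] that v \<open>G b = 0\<close> by (simp add: g_def)
    \<comment> \<open>Two one-sided derivatives at \<open>b\<close> are now available; they agree
      because the interval is nondegenerate.\<close>
    then have "(g has_vector_derivative 0) (at b within {a..b})"
      using \<open>a < b\<close> by (intro has_vector_derivative_transform[OF _ _ has_vector_derivative_const[of 0]]) auto
    with g[of b] \<open>a < b\<close> have "(K b *v v) \<bullet> (M *v (K b *v v)) = 0"
      by (auto simp: has_real_derivative_iff_has_vector_derivative
          intro: vector_derivative_unique_within_closed_interval[of a b b g])
    then have "K b *v v = 0"
      using M unfolding sym_pos_def_def by (metis less_irrefl)
    then show "v = 0"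
      by (metis matrix_inv_cancel(4)[OF K] matrix_vector_mult_0_right)
  qed
  then show ?thesis
    by (simp add: invertible_left_inverse matrix_left_invertible_ker)
qed

section \<open>Differentiating the solution of a linear system\<close>

lemma differentiable_det:
  fixes A :: "real \<Rightarrow> real^'n^'n"
  assumes "\<And>i j. (\<lambda>t. A t $ i $ j) differentiable (at t within S)"
  shows "(\<lambda>t. det (A t)) differentiable (at t within S)"
proof -
  have "(\<lambda>t. \<Prod>i\<in>UNIV. A t $ i $ p i) differentiable (at t within S)" for p
  proof -
    have "((\<lambda>t. A t $ i $ p i) has_derivative
        frechet_derivative (\<lambda>t. A t $ i $ p i) (at t within S)) (at t within S)" for i
      using assms by (simp only: frechet_derivative_works[symmetric])
    from has_derivative_prod[of UNIV "\<lambda>i t. A t $ i $ p i", OF this] show ?thesis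
      unfolding differentiable_def by blast
  qed
  then show ?thesis
    unfolding det_def by (intro differentiable_sum differentiable_mult) auto
qed

text \<open>Differentiability of \<open>x\<close> has to be established before the product rule can
  be used on A x = c. Cramer's rule provides it, writing each component as a quotient of
  determinants, which are polynomials in the entries.\<close>

lemma has_vector_derivative_linear_system:
  fixes A :: "real \<Rightarrow> real^'n^'n" and x c :: "real \<Rightarrow> real^'n" and a b :: real
  defines "S \<equiv> {a..b}"
  assumes "a < b"
    and A: "(A has_vector_derivative A') (at t within S)"
    and c: "(c has_vector_derivative c') (at t within S)"
    and inv: "\<And>s. s \<in> S \<Longrightarrow> invertible (A s)" and x: "\<And>s. s \<in> S \<Longrightarrow> A s *v x s = c s"
    and t: "t \<in> S"
  shows "(x has_vector_derivative matrix_inv (A t) *v (c' - A' *v x t)) (at t within S)"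
proof -
  have A_entry: "(\<lambda>s. A s $ i $ j) differentiable (at t within S)" for i j
    using bounded_linear.has_vector_derivative[OF bounded_linear_vec_nth
        bounded_linear.has_vector_derivative[OF bounded_linear_vec_nth A]]
    unfolding has_vector_derivative_def by (rule differentiableI)
  have c_entry: "(\<lambda>s. c s $ i) differentiable (at t within S)" for i
    using bounded_linear.has_vector_derivative[OF bounded_linear_vec_nth c]
    unfolding has_vector_derivative_def by (rule differentiableI)
  have det: "det (A s) \<noteq> 0" if "s \<in> S" for s
    using inv[OF that] by (simp add: invertible_det_nz)
  define y where "y s = (\<chi> k. det (\<chi> i j. if j = k then c s $ i else A s $ i $ j) / det (A s))" for s
  have xy: "x s = y s" if "s \<in> S" for s
    using cramer[OF det[OF that], of "x s" "c s"] x[OF that] by (simp add: y_def)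
  have "(\<lambda>s. y s $ k) differentiable (at t within S)" for k
    unfolding y_def vec_lambda_beta
  proof (intro differentiable_divide differentiable_det A_entry det t)
    show "(\<lambda>s. (\<chi> i j. if j = k then c s $ i else A s $ i $ j) $ i $ j) differentiable (at t within S)" for i j
      by (cases "j = k") (simp_all add: A_entry c_entry)
  qed
  then have "y differentiable (at t within S)"
    by (subst differentiable_componentwise_within) (auto simp: Basis_vec_def inner_axis)
  then have "x differentiable (at t within S)"
    by (rule differentiable_transform_within[OF _ zero_less_one t]) (simp add: xy)
  then obtain x' where x': "(x has_vector_derivative x') (at t within S)"
    using that[OF vector_derivative_works[THEN iffD1]] by blast
  have "((\<lambda>s. A s *v x s) has_vector_derivative A t *v x' + A' *v x t) (at t within S)"
    by (rule has_vector_derivative_matrix_vector_mult[OF A x'])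
  \<comment> \<open>This second expression for the derivative of \<open>c\<close> is compared with
    c' and solved for x'.\<close>
  then have "(c has_vector_derivative A t *v x' + A' *v x t) (at t within S)"
    by (rule has_vector_derivative_transform[OF t, rotated]) (simp add: x)
  then have "c' = A t *v x' + A' *v x t"
    using vector_derivative_unique_within_closed_interval[OF \<open>a < b\<close> t[unfolded S_def interval_cbox]
        c[unfolded S_def interval_cbox]]
    by (simp add: S_def flip: interval_cbox)
  then have "matrix_inv (A t) *v (c' - A' *v x t) = x'"
    by (simp add: matrix_inv_cancel(4)[OF inv[OF t]])
  with x' show ?thesis
    by simp
qed

subsection \<open>Integration by parts for square-integrable functions\<close>

text \<open>A countable Borel cover of finite measure serves the completion as well, since the two
  measures agree on Borel sets. Fubini's theorem below relies on it.\<close>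

lemma sigma_finite_lebesgue: "sigma_finite_measure (lebesgue :: 'a::euclidean_space measure)"
proof -
  obtain A :: "'a set set" where A: "countable A" "A \<subseteq> sets lborel" "\<Union>A = space lborel"
    "\<forall>a\<in>A. emeasure lborel a \<noteq> \<infinity>"
    using lborel.sigma_finite_countable by blast
  show ?thesis
    by standard (use A in \<open>force intro!: exI[of _ A]\<close>)
qed

text \<open>Fubini's theorem on the triangle a \<le> s \<le> t \<le> b, for integrands that are only
  integrable.\<close>

lemma set_integral_inner_swap:
  fixes f g :: "real \<Rightarrow> 'a::euclidean_space"
  assumes f: "set_integrable lebesgue {a..b} f" and g: "set_integrable lebesgue {a..b} g"
  shows "(LINT t:{a..b}|lebesgue. f t \<bullet> (LINT s:{a..t}|lebesgue. g s)) =
    (LINT s:{a..b}|lebesgue. (LINT t:{s..b}|lebesgue. f t) \<bullet> g s)"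
proof -
  interpret sigma_finite_measure "lebesgue :: real measure"
    by (rule sigma_finite_lebesgue)
  interpret pair_sigma_finite "lebesgue :: real measure" "lebesgue :: real measure" ..
  define F where "F t = indicator {a..b} t *\<^sub>R f t" for t
  define G where "G t = indicator {a..b} t *\<^sub>R g t" for t
  have F: "integrable lebesgue F" and G: "integrable lebesgue G"
    using f g unfolding set_integrable_def F_def[abs_def] G_def[abs_def] by auto
  note [measurable] = borel_measurable_integrable[OF F] borel_measurable_integrable[OF G]
  \<comment> \<open>The cutoffs inside \<open>F\<close> and \<open>G\<close> restrict to the square,
    the indicator to its triangle s \<le> t.\<close>
  define h where "h t s = indicator {..t} s *\<^sub>R (F t \<bullet> G s)" for t s :: real
  have id: "(\<lambda>t. t) \<in> borel_measurable (lebesgue :: real measure)"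
    by (intro measurable_completion) simp
  \<comment> \<open>The product is formed from two complete measure spaces, so the projections reach
    the Borel sets through the identity from \<open>lebesgue\<close>. The comparison of s and t is
    then measurable.\<close>
  have [measurable]: "fst \<in> borel_measurable ((lebesgue :: real measure) \<Otimes>\<^sub>M (lebesgue :: real measure))"
    "snd \<in> borel_measurable ((lebesgue :: real measure) \<Otimes>\<^sub>M (lebesgue :: real measure))"
    using measurable_compose[OF measurable_fst id] measurable_compose[OF measurable_snd id] by auto
  have h_alt: "case_prod h = (\<lambda>p. if snd p \<le> fst p then F (fst p) \<bullet> G (snd p) else 0)"
    by (auto simp: h_def fun_eq_iff indicator_def)
  have [measurable]: "case_prod h \<in> borel_measurable (lebesgue \<Otimes>\<^sub>M lebesgue)"
    unfolding h_alt by measurable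
  have h_le: "norm (h t s) \<le> norm (F t) * norm (G s)" for t s
    by (auto simp: h_def indicator_def Cauchy_Schwarz_ineq2)
  have int_s: "integrable lebesgue (h t)" for t
  proof (rule Bochner_Integration.integrable_bound)
    show "integrable lebesgue (\<lambda>s. norm (F t) * norm (G s))"
      using G by auto
    have [measurable]: "{..t} \<in> sets lebesgue"
      by simp
    show "h t \<in> borel_measurable lebesgue"
      unfolding h_def[abs_def] by measurable
  qed (use h_le in auto)
  \<comment> \<open>Joint integrability comes from the dominating product |F t| |G s|, whose inner
    integral is a constant multiple of |F t|.\<close>
  have int_h: "integrable (lebesgue \<Otimes>\<^sub>M lebesgue) (case_prod h)"
  proof (rule Fubini_integrable)
    show "integrable lebesgue (\<lambda>t. LINT s|lebesgue. norm (case_prod h (t, s)))"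
    proof (rule Bochner_Integration.integrable_bound)
      show "integrable lebesgue (\<lambda>t. norm (F t) * (LINT s|lebesgue. norm (G s)))"
        using F by auto
      have "(LINT s|lebesgue. norm (h t s)) \<le> norm (F t) * (LINT s|lebesgue. norm (G s))" for t
      proof -
        have "(LINT s|lebesgue. norm (h t s)) \<le> (LINT s|lebesgue. norm (F t) * norm (G s))"
          by (rule integral_mono) (use int_s[of t] G h_le in auto)
        then show ?thesis by simp
      qed
      then show "AE t in lebesgue. norm (LINT s|lebesgue. norm (case_prod h (t, s)))
          \<le> norm (norm (F t) * (LINT s|lebesgue. norm (G s)))"
        by simp
    qed measurable
  qed (use int_s in auto)
  have left: "(LINT s|lebesgue. h t s) = indicator {a..b} t *\<^sub>R (f t \<bullet> (LINT s:{a..t}|lebesgue. g s))"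
    for t
  proof (cases "t \<in> {a..b}")
    case True
    then have "h t = (\<lambda>s. f t \<bullet> (indicator {a..t} s *\<^sub>R g s))"
      by (auto simp: h_def F_def G_def fun_eq_iff indicator_def)
    moreover have "integrable lebesgue (\<lambda>s. indicator {a..t} s *\<^sub>R g s)"
      using set_integrable_subset[OF g, of "{a..t}"] True by (auto simp: set_integrable_def)
    ultimately show ?thesis
      using True by (simp add: set_lebesgue_integral_def del: inner_scaleR_left inner_scaleR_right)
  qed (simp add: h_def F_def)
  have right: "(LINT t|lebesgue. h t s) = indicator {a..b} s *\<^sub>R ((LINT t:{s..b}|lebesgue. f t) \<bullet> g s)"
    for s
  proof (cases "s \<in> {a..b}")
    case True
    then have "(\<lambda>t. h t s) = (\<lambda>t. (indicator {s..b} t *\<^sub>R f t) \<bullet> g s)"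
      by (auto simp: h_def F_def G_def fun_eq_iff indicator_def)
    moreover have "integrable lebesgue (\<lambda>t. indicator {s..b} t *\<^sub>R f t)"
      using set_integrable_subset[OF f, of "{s..b}"] True by (auto simp: set_integrable_def)
    ultimately show ?thesis
      using True by (simp add: set_lebesgue_integral_def del: inner_scaleR_left inner_scaleR_right)
  qed (simp add: h_def G_def)
  show ?thesis
    using Fubini_integral[OF int_h] by (simp add: left right set_lebesgue_integral_def)
qed

lemma set_integral_FTC:
  fixes p q :: "real \<Rightarrow> 'a::euclidean_space"
  assumes "a \<le> b"
    and p: "\<And>t. t \<in> {a..b} \<Longrightarrow> (p has_vector_derivative q t) (at t within {a..b})"
    and q: "continuous_on {a..b} q"
  shows "(LINT t:{a..b}|lebesgue. q t) = p b - p a"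
proof -
  have "(LINT t:{a..b}|lebesgue. q t) = integral {a..b} q"
    by (rule set_lebesgue_integral_eq_integral(2)[OF absolutely_integrable_continuous_real[OF q]])
  also have "\<dots> = p b - p a"
    using fundamental_theorem_of_calculus[OF \<open>a \<le> b\<close>, of p q] p by (simp add: integral_unique)
  finally show ?thesis .
qed

lemma set_integrable_inner_continuous:
  fixes f g :: "real \<Rightarrow> 'a::euclidean_space"
  assumes f: "continuous_on {a..b} f" and g: "set_integrable lebesgue {a..b} g"
  shows "set_integrable lebesgue {a..b} (\<lambda>t. f t \<bullet> g t)"
proof -
  have "bounded (f ` {a..b})"
    by (intro compact_imp_bounded compact_continuous_image f compact_Icc)
  then show ?thesis
    using absolutely_integrable_bounded_measurable_product[OF
        bilinear_conv_bounded_bilinear[THEN iffD2, OF bounded_bilinear_inner] _ _ _ g, of f]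
      continuous_imp_measurable_on_sets_lebesgue[OF f]
    by simp
qed

text \<open>As \<open>v\<close> is merely integrable, its primitive need not be differentiable
  everywhere. Exchanging the integrals moves the work to \<open>q\<close>, whose integral from s to
  \<open>b\<close> is \<open>p b - p s\<close>.\<close>

lemma set_integral_by_parts:
  fixes p q v :: "real \<Rightarrow> 'a::euclidean_space"
  assumes p: "\<And>t. t \<in> {a..b} \<Longrightarrow> (p has_vector_derivative q t) (at t within {a..b})"
    and q: "continuous_on {a..b} q" and v: "set_integrable lebesgue {a..b} v"
  shows "(LINT t:{a..b}|lebesgue. q t \<bullet> (LINT s:{a..t}|lebesgue. v s)) =
    p b \<bullet> (LINT t:{a..b}|lebesgue. v t) - (LINT t:{a..b}|lebesgue. p t \<bullet> v t)"
proof -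
  have p_cont: "continuous_on {a..b} p"
    by (meson p continuous_on_eq_continuous_within has_vector_derivative_continuous)
  have "(LINT t:{a..b}|lebesgue. q t \<bullet> (LINT s:{a..t}|lebesgue. v s)) =
      (LINT s:{a..b}|lebesgue. (LINT t:{s..b}|lebesgue. q t) \<bullet> v s)"
    by (rule set_integral_inner_swap[OF absolutely_integrable_continuous_real[OF q] v])
  also have "\<dots> = (LINT s:{a..b}|lebesgue. p b \<bullet> v s - p s \<bullet> v s)"
  proof (rule set_lebesgue_integral_cong)
    show "\<forall>s. s \<in> {a..b} \<longrightarrow> (LINT t:{s..b}|lebesgue. q t) \<bullet> v s = p b \<bullet> v s - p s \<bullet> v s"
    proof safe
      fix s assume s: "s \<in> {a..b}"
      have "(LINT t:{s..b}|lebesgue. q t) = p b - p s"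
        by (rule set_integral_FTC)
          (use s in \<open>auto intro: has_vector_derivative_within_subset[OF p] continuous_on_subset[OF q]\<close>)
      then show "(LINT t:{s..b}|lebesgue. q t) \<bullet> v s = p b \<bullet> v s - p s \<bullet> v s"
        by (simp add: inner_diff_left)
    qed
  qed simp
  also have "\<dots> = (LINT s:{a..b}|lebesgue. p b \<bullet> v s) - (LINT s:{a..b}|lebesgue. p s \<bullet> v s)"
    by (intro set_integral_diff set_integrable_inner_continuous p_cont continuous_on_const v)
  also have "(LINT s:{a..b}|lebesgue. p b \<bullet> v s) = p b \<bullet> (LINT t:{a..b}|lebesgue. v t)"
    using v by (simp add: set_lebesgue_integral_def set_integrable_def flip: inner_scaleR_right)
  finally show ?thesis .
qed

lemma square_integrable_imp_set_integrable:
  assumes "square_integrable a b (u :: real \<Rightarrow> 'a::euclidean_space)"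
  shows "set_integrable lebesgue {a..b} u"
proof (rule set_integrable_bound)
  show "set_integrable lebesgue {a..b} (\<lambda>t. 1 + (norm (u t))\<^sup>2)"
    using assms unfolding square_integrable_def by (intro set_integral_add) auto
  show "set_borel_measurable lebesgue {a..b} u"
    using assms by (simp add: square_integrable_def)
  \<comment> \<open>Expanding (|u| - 1/2)^2 \<ge> 0 gives |u| \<le> |u|^2 + 1/4.\<close>
  have "norm (u t) \<le> norm (1 + (norm (u t))\<^sup>2)" for t
    using sum_power2_ge_zero[of "norm (u t) - 1/2" 0] by (simp add: power2_eq_square algebra_simps)
  then show "AE t in lebesgue. t \<in> {a..b} \<longrightarrow> norm (u t) \<le> norm (1 + (norm (u t))\<^sup>2)"
    by blast
qed

subsection \<open>The reference path and the tracking cost\<close>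

text \<open>The curve is continuous only on the unit interval, so the parameter must stay there. It
  sweeps 0 to c/2 and then c/2 to 1, with \<open>c\<close> between 0 and 2 because \<delta> lies
  between 0 and \<open>L\<close>.\<close>

lemma traversal_mem:
  assumes "a < b" "0 < L" "0 \<le> \<delta>" "\<delta> \<le> L" "s = 1 \<or> s = - 1" "t \<in> {a..b}"
  shows "traversal a b L \<delta> s t \<in> {0..1}"
proof -
  define c where "c = (L + s * \<delta>) / L"
  have c: "0 \<le> c" "c \<le> 2" "(L - s * \<delta>) / L = 2 - c" "(L + s * \<delta>) / (2 * L) = c / 2"
    using assms by (auto simp: c_def field_simps)
  show ?thesis
  proof (cases "t \<le> (a + b) / 2")
    case True
    have "0 \<le> (t - a) / (b - a)" "(t - a) / (b - a) \<le> 1 / 2"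
      using assms True by (auto simp: field_simps)
    then have "0 \<le> (t - a) / (b - a) * c" "(t - a) / (b - a) * c \<le> 1 / 2 * 2"
      by (intro mult_nonneg_nonneg mult_mono c; simp)+
    then show ?thesis
      using True by (simp add: traversal_def flip: c_def)
  next
    case False
    have "0 \<le> (t - (a + b) / 2) / (b - a)" "(t - (a + b) / 2) / (b - a) \<le> 1 / 2"
      using assms False by (auto simp: field_simps)
    then have "0 \<le> (t - (a + b) / 2) / (b - a) * (2 - c)"
      "(t - (a + b) / 2) / (b - a) * (2 - c) \<le> 1 / 2 * (2 - c)"
      using c(2) by (intro mult_nonneg_nonneg mult_right_mono; simp)+
    moreover have "traversal a b L \<delta> s t = (t - (a + b) / 2) / (b - a) * (2 - c) + c / 2"
      using False by (simp only: traversal_def c if_False)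
    ultimately show ?thesis
      using c by auto
  qed
qed

lemma continuous_on_traversal:
  assumes "a < b" "0 < L"
  shows "continuous_on S (traversal a b L \<delta> s)"
  unfolding traversal_def[abs_def]
proof (rule continuous_on_cases_le)
  fix t assume t: "t = (a + b) / 2"
  have half: "((a + b) / 2 - a) / (b - a) = 1 / 2"
    using assms by (simp add: field_simps)
  show "(t - a) / (b - a) * ((L + s * \<delta>) / L) =
      (t - (a + b) / 2) / (b - a) * ((L - s * \<delta>) / L) + (L + s * \<delta>) / (2 * L)"
    unfolding t half by simp
qed (use assms in \<open>auto intro!: continuous_intros\<close>)

section \<open>Trajectories and integrability of the running cost\<close>

text \<open>Links the integral definition of the state, used for all admissible controls, with
  classical solutions of the closed loop.\<close>

lemma trajectory_eq:
  fixes x :: "real \<Rightarrow> 'a::euclidean_space"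
  assumes x: "\<And>t. t \<in> {a..b} \<Longrightarrow> (x has_vector_derivative u t) (at t within {a..b})"
    and u: "continuous_on {a..b} u" and t: "t \<in> {a..b}"
  shows "trajectory a (x a) u t = x t"
proof -
  have "(LINT \<tau>:{a..t}|lebesgue. u \<tau>) = x t - x a"
    by (rule set_integral_FTC)
      (use t in \<open>auto intro: has_vector_derivative_within_subset[OF x] continuous_on_subset[OF u]\<close>)
  then show ?thesis
    by (simp add: trajectory_def)
qed

lemma continuous_on_trajectory:
  assumes "set_integrable lebesgue {a..b} (u :: real \<Rightarrow> 'a::euclidean_space)"
  shows "continuous_on {a..b} (trajectory a x0 u)"
proof -
  have "continuous_on {a..b} (\<lambda>t. x0 + integral {a..t} u)"
    by (intro continuous_intros indefinite_integral_continuous_1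
        set_lebesgue_integral_eq_integral(1)[OF assms])
  moreover have "x0 + integral {a..t} u = trajectory a x0 u t" if "t \<in> {a..b}" for t
    using set_lebesgue_integral_eq_integral(2)[OF set_integrable_subset[OF assms, of "{a..t}"]] that
    by (simp add: trajectory_def)
  ultimately show ?thesis
    by (rule continuous_on_eq)
qed

lemma continuous_imp_square_integrable:
  assumes "continuous_on {a..b} (u :: real \<Rightarrow> 'a::euclidean_space)"
  shows "square_integrable a b u"
proof -
  have "set_integrable lebesgue {a..b} (\<lambda>t. (norm (u t))\<^sup>2)"
    by (intro absolutely_integrable_continuous_real continuous_intros assms)
  moreover have "set_borel_measurable lebesgue {a..b} u"
    using absolutely_integrable_continuous_real[OF assms]
    by (simp add: set_integrable_def set_borel_measurable_def borel_measurable_integrable)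
  ultimately show ?thesis
    by (simp add: square_integrable_def)
qed

lemma set_integrable_quadratic_form:
  fixes R :: "real^'n^'n"
  assumes u: "square_integrable a b u"
  shows "set_integrable lebesgue {a..b} (\<lambda>t. u t \<bullet> (R *v u t))"
proof -
  obtain C where C: "0 < C" "\<And>(X :: real^'n^'n) v. norm (X *v v) \<le> norm X * norm v * C"
    using bounded_bilinear.pos_bounded[OF bounded_bilinear_matrix_vector_mult] by blast
  show ?thesis
  proof (rule set_integrable_bound)
    show "set_integrable lebesgue {a..b} (\<lambda>t. (norm R * C) * (norm (u t))\<^sup>2)"
      using u by (auto simp: square_integrable_def)
    have "continuous_on UNIV (\<lambda>y. y \<bullet> (R *v y))"
      by (intro continuous_intros continuous_on_matrix_vector_mult)
    moreover have "(\<lambda>t. indicator {a..b} t *\<^sub>R u t) \<in> borel_measurable lebesgue"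
      using u by (simp add: square_integrable_def set_borel_measurable_def)
    ultimately have "(\<lambda>t. (indicator {a..b} t *\<^sub>R u t) \<bullet> (R *v (indicator {a..b} t *\<^sub>R u t)))
        \<in> borel_measurable lebesgue"
      by (rule borel_measurable_continuous_on)
    \<comment> \<open>Only the cut-off control is known to be measurable. A quadratic form vanishes
      at 0, so the cutoff can be pulled out of it.\<close>
    moreover have "(indicator {a..b} t *\<^sub>R u t) \<bullet> (R *v (indicator {a..b} t *\<^sub>R u t)) =
        indicator {a..b} t *\<^sub>R (u t \<bullet> (R *v u t))" for t
      by (simp add: indicator_def)
    ultimately show "set_borel_measurable lebesgue {a..b} (\<lambda>t. u t \<bullet> (R *v u t))"
      by (simp only: set_borel_measurable_def)
    have "norm (u t \<bullet> (R *v u t)) \<le> norm ((norm R * C) * (norm (u t))\<^sup>2)" for t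
    proof -
      have "norm (u t \<bullet> (R *v u t)) \<le> norm (u t) * norm (R *v u t)"
        by (simp add: Cauchy_Schwarz_ineq2)
      also have "\<dots> \<le> norm (u t) * (norm R * norm (u t) * C)"
        by (intro mult_left_mono C) simp
      finally show ?thesis
        using C(1) by (simp add: power2_eq_square mult_ac)
    qed
    then show "AE t in lebesgue. t \<in> {a..b} \<longrightarrow> norm (u t \<bullet> (R *v u t)) \<le> norm ((norm R * C) * (norm (u t))\<^sup>2)"
      by blast
  qed
qed

lemma set_integrable_tracking_integrand:
  fixes Q R :: "real^'n^'n"
  assumes u: "square_integrable a b u" and r: "continuous_on {a..b} r"
  shows "set_integrable lebesgue {a..b} (\<lambda>t. (trajectory a x0 u t - r t) \<bullet> (Q *v (trajectory a x0 u t - r t))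
    + u t \<bullet> (R *v u t))"
  by (intro set_integral_add set_integrable_quadratic_form u absolutely_integrable_continuous_real
      continuous_intros continuous_on_matrix_vector_mult r
      continuous_on_trajectory square_integrable_imp_set_integrable)

section \<open>Sufficiency of the costate equations\<close>

lemma quadratic_form_add:
  fixes A :: "real^'n^'n"
  assumes "transpose A = A"
  shows "(x + y) \<bullet> (A *v (x + y)) = x \<bullet> (A *v x) + 2 * ((A *v x) \<bullet> y) + y \<bullet> (A *v y)"
proof -
  have "x \<bullet> (A *v y) = (A *v x) \<bullet> y"
    by (subst inner_matrix_vector_transpose) (simp only: assms)
  then show ?thesis
    by (simp add: matrix_vector_right_distrib inner_add inner_commute)
qed

text \<open>Pontryagin's conditions are sufficient because the cost is convex: perturbing the control by
  \<open>w\<close> and the trajectory by \<open>z\<close>, the first-order term \<open>\<integral> p' \<bullet> z + p \<bullet> w\<close> is the boundary term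
  \<open>p b \<bullet> z b = 0\<close>.\<close>

lemma costate_imp_minimizer:
  fixes Q R :: "real^'n^'n"
  assumes "a \<le> b" and Q: "sym_pos_def Q" and R: "sym_pos_def R" and r: "continuous_on {a..b} r"
    and x: "\<And>t. t \<in> {a..b} \<Longrightarrow> (x has_vector_derivative u t) (at t within {a..b})"
    and u: "continuous_on {a..b} u"
    and p: "\<And>t. t \<in> {a..b} \<Longrightarrow> (p has_vector_derivative Q *v (x t - r t)) (at t within {a..b})"
    and pu: "\<And>t. t \<in> {a..b} \<Longrightarrow> R *v u t = p t"
  shows "is_minimizer_on (tracking_cost a b (x a) r Q R) {u. admissible_control a b (x a) (x b) u} u"
  unfolding is_minimizer_on_def mem_Collect_eq
proof safe
  have x_eq: "trajectory a (x a) u t = x t" if "t \<in> {a..b}" for t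
    by (rule trajectory_eq[OF x u that])
  have x_cont: "continuous_on {a..b} x"
    by (meson x continuous_on_eq_continuous_within has_vector_derivative_continuous)
  have p_cont: "continuous_on {a..b} p"
    by (meson p continuous_on_eq_continuous_within has_vector_derivative_continuous)
  have q_cont: "continuous_on {a..b} (\<lambda>t. Q *v (x t - r t))"
    by (intro continuous_intros continuous_on_matrix_vector_mult x_cont r)
  show "admissible_control a b (x a) (x b) u"
    using \<open>a \<le> b\<close> x_eq[of b] by (simp add: admissible_control_def continuous_imp_square_integrable[OF u])
  fix v assume "admissible_control a b (x a) (x b) v"
  then have v: "square_integrable a b v" "trajectory a (x a) v b = x b"
    by (auto simp: admissible_control_def)
  have v_int: "set_integrable lebesgue {a..b} v" and u_int: "set_integrable lebesgue {a..b} u"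
    by (rule square_integrable_imp_set_integrable[OF v(1)])
      (rule absolutely_integrable_continuous_real[OF u])
  define w where "w t = v t - u t" for t
  define z where "z t = trajectory a (x a) v t - x t" for t
  have w_int: "set_integrable lebesgue {a..b} w"
    unfolding w_def[abs_def] by (rule set_integral_diff(1)[OF v_int u_int])
  have z_eq: "z t = (LINT s:{a..t}|lebesgue. w s)" if "t \<in> {a..b}" for t
  proof -
    have "(LINT s:{a..t}|lebesgue. w s) = (LINT s:{a..t}|lebesgue. v s) - (LINT s:{a..t}|lebesgue. u s)"
      unfolding w_def
      by (rule set_integral_diff(2)) (use that in \<open>auto intro: set_integrable_subset[OF v_int] set_integrable_subset[OF u_int]\<close>)
    then show ?thesis
      by (simp add: z_def trajectory_def flip: x_eq[OF that])
  qed
  have z_cont: "continuous_on {a..b} z"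
    unfolding z_def[abs_def] by (intro continuous_intros continuous_on_trajectory v_int x_cont)
  define cost where "cost y v t = (y t - r t) \<bullet> (Q *v (y t - r t)) + v t \<bullet> (R *v v t)"
    for y v :: "real \<Rightarrow> real^'n" and t
  \<comment> \<open>\<open>cost\<close> lacks the factor 1/2 of the functional, so
    \<open>first\<close> is half its first variation and enters doubled below.\<close>
  define first where "first t = (Q *v (x t - r t)) \<bullet> z t + p t \<bullet> w t" for t
  have first_int1: "set_integrable lebesgue {a..b} (\<lambda>t. (Q *v (x t - r t)) \<bullet> z t)"
    by (intro absolutely_integrable_continuous_real continuous_on_inner q_cont z_cont)
  have first_int2: "set_integrable lebesgue {a..b} (\<lambda>t. p t \<bullet> w t)"
    by (rule set_integrable_inner_continuous[OF p_cont w_int])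
  have first_int: "set_integrable lebesgue {a..b} first"
    unfolding first_def[abs_def] by (rule set_integral_add(1)[OF first_int1 first_int2])
  have "(LINT t:{a..b}|lebesgue. (Q *v (x t - r t)) \<bullet> z t) =
      (LINT t:{a..b}|lebesgue. (Q *v (x t - r t)) \<bullet> (LINT s:{a..t}|lebesgue. w s))"
    by (rule set_lebesgue_integral_cong) (auto simp: z_eq)
  also have "\<dots> = p b \<bullet> z b - (LINT t:{a..b}|lebesgue. p t \<bullet> w t)"
    using set_integral_by_parts[OF p q_cont w_int] z_eq[of b] \<open>a \<le> b\<close> by simp
  \<comment> \<open>Both trajectories end at \<open>x b\<close>; this is where the terminal
    constraint enters.\<close>
  also have "z b = 0"
    by (simp add: z_def v)
  finally have first_zero: "(LINT t:{a..b}|lebesgue. first t) = 0"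
    unfolding first_def by (simp add: set_integral_add(2)[OF first_int1 first_int2])
  have cost_v_int: "set_integrable lebesgue {a..b} (cost (trajectory a (x a) v) v)"
    unfolding cost_def[abs_def] by (rule set_integrable_tracking_integrand[OF v(1) r])
  have cost_u_int: "set_integrable lebesgue {a..b} (cost x u)"
    unfolding cost_def[abs_def]
    by (intro absolutely_integrable_continuous_real continuous_intros continuous_on_matrix_vector_mult
        x_cont r u)
  \<comment> \<open>Expanding both quadratic forms about the candidate, with R u = p in the linear
    term, leaves the nonnegative remainders z \<bullet> Q z and w \<bullet> R w.\<close>
  have cost_le: "cost x u t + 2 * first t \<le> cost (trajectory a (x a) v) v t" if t: "t \<in> {a..b}" for t
  proof -
    have "(trajectory a (x a) v t - r t) \<bullet> (Q *v (trajectory a (x a) v t - r t)) =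
        (x t - r t) \<bullet> (Q *v (x t - r t)) + 2 * ((Q *v (x t - r t)) \<bullet> z t) + z t \<bullet> (Q *v z t)"
      using quadratic_form_add[of Q "x t - r t" "z t"] Q
      by (simp add: z_def sym_pos_def_def algebra_simps)
    moreover have "v t \<bullet> (R *v v t) = u t \<bullet> (R *v u t) + 2 * (p t \<bullet> w t) + w t \<bullet> (R *v w t)"
      using quadratic_form_add[of R "u t" "w t"] R pu[OF t]
      by (simp add: w_def sym_pos_def_def)
    ultimately show ?thesis
      using sym_pos_def_inner_nonneg[OF Q, of "z t"] sym_pos_def_inner_nonneg[OF R, of "w t"]
      by (simp add: cost_def first_def)
  qed
  have "(LINT t:{a..b}|lebesgue. cost x u t) = (LINT t:{a..b}|lebesgue. cost x u t + 2 * first t)"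
    using cost_u_int first_int first_zero by (simp add: set_integral_add(2))
  also have "\<dots> \<le> (LINT t:{a..b}|lebesgue. cost (trajectory a (x a) v) v t)"
    by (rule set_integral_mono)
      (use cost_u_int cost_v_int first_int cost_le in \<open>auto intro!: set_integral_add(1)\<close>)
  also have "(LINT t:{a..b}|lebesgue. cost x u t) = (LINT t:{a..b}|lebesgue. cost (trajectory a (x a) u) u t)"
    by (rule set_lebesgue_integral_cong) (auto simp: cost_def x_eq)
  finally show "tracking_cost a b (x a) r Q R u \<le> tracking_cost a b (x a) r Q R v"
    by (simp add: tracking_cost_def cost_def)
qed

subsection \<open>The closed loop\<close>

lemma has_vector_derivative_quadratic_form:
  fixes H :: "real \<Rightarrow> real^'n^'n"
  assumes H: "(H has_vector_derivative H') (at t within S)" and sym: "transpose (H t) = H t"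
    and x: "(x has_vector_derivative x') (at t within S)"
  shows "((\<lambda>t. x t \<bullet> (H t *v x t)) has_vector_derivative
    2 * (x' \<bullet> (H t *v x t)) + x t \<bullet> (H' *v x t)) (at t within S)"
proof -
  have "x t \<bullet> (H t *v x') = x' \<bullet> (H t *v x t)"
    by (subst inner_matrix_vector_transpose) (simp only: sym inner_commute)
  then show ?thesis
    using has_vector_derivative_inner[OF x has_vector_derivative_matrix_vector_mult[OF H x]]
    by (simp add: inner_add_right algebra_simps)
qed

text \<open>The value function \<open>V t y = y \<bullet> H t y / 2 + y \<bullet> \<Lambda> t + \<phi> t\<close> solves the
  Hamilton-Jacobi-Bellman equation, so along the closed loop its derivative is minus the running cost.\<close>

lemma tracking_cost_feedback:
  fixes Q R :: "real^'n^'n" and \<Lambda> r x u :: "real \<Rightarrow> real^'n"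
  defines "M \<equiv> matrix_inv R"
  assumes "a \<le> b" and R: "sym_pos_def R" and Q: "transpose Q = Q" and r: "continuous_on {a..b} r"
    and H: "solves_on H (\<lambda>t X. X ** M ** X - Q) a b"
    and H_sym: "\<And>t. t \<in> {a..b} \<Longrightarrow> transpose (H t) = H t"
    and \<Lambda>: "solves_on \<Lambda> (\<lambda>t y. (H t ** M) *v y + Q *v r t) a b"
    and \<phi>: "solves_on \<phi> (\<lambda>t y. 1/2 * (\<Lambda> t \<bullet> (M *v \<Lambda> t)) - 1/2 * (r t \<bullet> (Q *v r t))) a b"
    and x: "solves_on x (\<lambda>t y. - (M *v (H t *v y + \<Lambda> t))) a b"
    and u: "\<And>t. u t = - (M *v (H t *v x t + \<Lambda> t))"
  shows "tracking_cost a b (x a) r Q R u =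
    (1/2 * (x a \<bullet> (H a *v x a)) + x a \<bullet> \<Lambda> a + \<phi> a) - (1/2 * (x b \<bullet> (H b *v x b)) + x b \<bullet> \<Lambda> b + \<phi> b)"
proof -
  have M: "sym_pos_def M"
    unfolding M_def by (rule sym_pos_def_matrix_inv[OF R])
  then have M_sym: "transpose M = M"
    by (simp add: sym_pos_def_def)
  note cont = solves_on_continuous_on[OF H] solves_on_continuous_on[OF \<Lambda>] solves_on_continuous_on[OF x]
  have u_cont: "continuous_on {a..b} u"
    unfolding u[abs_def] by (intro continuous_intros continuous_on_matrix_vector_mult cont)
  have dx: "(x has_vector_derivative u t) (at t within {a..b})" if "t \<in> {a..b}" for t
    using solves_onD[OF x that] by (simp only: u)
  define V where "V t = 1/2 * (x t \<bullet> (H t *v x t)) + x t \<bullet> \<Lambda> t + \<phi> t" for t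
  define cost where "cost t = (x t - r t) \<bullet> (Q *v (x t - r t)) + u t \<bullet> (R *v u t)" for t
  have dV: "(V has_vector_derivative - 1/2 * cost t) (at t within {a..b})" if t: "t \<in> {a..b}" for t
  proof -
    define h where "h = H t *v x t"
    have Ru: "R *v u t = - (h + \<Lambda> t)"
      using matrix_inv_cancel(3)[OF sym_pos_def_invertible[OF R]]
      by (simp add: u h_def M_def linear_neg[OF matrix_vector_mul_linear])
    have H_swap: "x t \<bullet> (H t *v y) = h \<bullet> y" for y
      unfolding h_def by (subst inner_matrix_vector_transpose) (simp only: H_sym[OF t])
    have M_swap: "y \<bullet> (M *v y') = y' \<bullet> (M *v y)" for y y'
      by (subst inner_matrix_vector_transpose) (simp only: M_sym inner_commute)
    have Q_swap: "y \<bullet> (Q *v y') = y' \<bullet> (Q *v y)" for y y'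
      by (subst inner_matrix_vector_transpose) (simp only: Q inner_commute)
    have u_alt: "u t = - (M *v h + M *v \<Lambda> t)"
      by (simp add: u h_def matrix_vector_right_distrib)
    \<comment> \<open>The feedback minimizes the Hamiltonian, so R u = -(h + \<Lambda>) and the
      control cost becomes the \<open>M\<close>-form of h + \<Lambda>. The Riccati, \<Lambda> and
      \<phi> equations supply its h-h, h-\<Lambda> and \<Lambda>-\<Lambda> parts in the derivative
      of \<open>V\<close>.\<close>
    have uRu: "u t \<bullet> (R *v u t) = (M *v h + M *v \<Lambda> t) \<bullet> (h + \<Lambda> t)"
      unfolding Ru by (simp only: u_alt inner_minus_left inner_minus_right minus_minus)
    have "(V has_vector_derivative
        1/2 * (2 * (u t \<bullet> h) + x t \<bullet> ((H t ** M ** H t - Q) *v x t))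
        + (x t \<bullet> ((H t ** M) *v \<Lambda> t + Q *v r t) + u t \<bullet> \<Lambda> t)
        + (1/2 * (\<Lambda> t \<bullet> (M *v \<Lambda> t)) - 1/2 * (r t \<bullet> (Q *v r t)))) (at t within {a..b})"
      unfolding V_def[abs_def] h_def
      by (intro has_vector_derivative_add has_vector_derivative_mult_right has_vector_derivative_inner
          has_vector_derivative_quadratic_form dx[OF t] solves_onD[OF H t] solves_onD[OF \<Lambda> t]
          solves_onD[OF \<phi> t] H_sym[OF t])
    also have "x t \<bullet> ((H t ** M ** H t - Q) *v x t) = h \<bullet> (M *v h) - x t \<bullet> (Q *v x t)"
      by (simp add: matrix_vector_mult_diff_rdistrib inner_diff_right H_swap h_def[symmetric]
          matrix_vector_mul_assoc[symmetric])
    also have "x t \<bullet> ((H t ** M) *v \<Lambda> t + Q *v r t) = h \<bullet> (M *v \<Lambda> t) + x t \<bullet> (Q *v r t)"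
      by (simp add: inner_add_right H_swap matrix_vector_mul_assoc[symmetric])
    also have "1/2 * (2 * (u t \<bullet> h) + (h \<bullet> (M *v h) - x t \<bullet> (Q *v x t)))
        + (h \<bullet> (M *v \<Lambda> t) + x t \<bullet> (Q *v r t) + u t \<bullet> \<Lambda> t)
        + (1/2 * (\<Lambda> t \<bullet> (M *v \<Lambda> t)) - 1/2 * (r t \<bullet> (Q *v r t))) = - 1/2 * cost t"
      using M_swap[of "\<Lambda> t" h] Q_swap[of "r t" "x t"]
      by (simp add: cost_def uRu, simp add: u_alt inner_diff inner_add matrix_vector_mult_diff_distrib
          inner_commute[of "M *v _"] field_simps)
    finally show ?thesis .
  qed
  have cost_cont: "continuous_on {a..b} cost"
    unfolding cost_def[abs_def]
    by (intro continuous_intros continuous_on_matrix_vector_mult cont r u_cont)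
  have "(LINT t:{a..b}|lebesgue. - 1/2 * cost t) = V b - V a"
    by (rule set_integral_FTC[OF \<open>a \<le> b\<close>])
      (rule dV, assumption, intro continuous_intros cost_cont)
  moreover have "(LINT t:{a..b}|lebesgue. - 1/2 * cost t) = - 1/2 * (LINT t:{a..b}|lebesgue. cost t)"
    by (rule set_integral_mult_right)
  moreover have "trajectory a (x a) u t = x t" if "t \<in> {a..b}" for t
    by (rule trajectory_eq[OF dx u_cont that])
  then have "tracking_cost a b (x a) r Q R u = 1/2 * (LINT t:{a..b}|lebesgue. cost t)"
    unfolding tracking_cost_def
    by (intro arg_cong[of _ _ "\<lambda>y. 1/2 * y"] set_lebesgue_integral_cong)
      (auto simp: cost_def)
  ultimately show ?thesis
    by (simp add: V_def)
qed

text \<open>Differentiating H x + \<Lambda> along the closed loop, the H M H and H M \<Lambda> terms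
  cancel, leaving only the \<open>Q\<close> terms. This is the adjoint equation required for
  optimality.\<close>

lemma costate_has_vector_derivative:
  fixes M Q :: "real^'n^'n" and \<Lambda> r x :: "real \<Rightarrow> real^'n"
  assumes H: "solves_on H (\<lambda>t X. X ** M ** X - Q) a b"
    and \<Lambda>: "solves_on \<Lambda> (\<lambda>t y. (H t ** M) *v y + Q *v r t) a b"
    and x: "solves_on x (\<lambda>t y. - (M *v (H t *v y + \<Lambda> t))) a b"
    and t: "t \<in> {a..b}"
  shows "((\<lambda>t. - (H t *v x t + \<Lambda> t)) has_vector_derivative Q *v (x t - r t)) (at t within {a..b})"
proof -
  have "((\<lambda>t. - (H t *v x t + \<Lambda> t)) has_vector_derivative
      - ((H t *v (- (M *v (H t *v x t + \<Lambda> t))) + (H t ** M ** H t - Q) *v x t)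
        + ((H t ** M) *v \<Lambda> t + Q *v r t))) (at t within {a..b})"
    by (intro has_vector_derivative_minus has_vector_derivative_add
        has_vector_derivative_matrix_vector_mult solves_onD[OF H t] solves_onD[OF x t] solves_onD[OF \<Lambda> t])
  also have "- ((H t *v (- (M *v (H t *v x t + \<Lambda> t))) + (H t ** M ** H t - Q) *v x t)
        + ((H t ** M) *v \<Lambda> t + Q *v r t)) = Q *v (x t - r t)"
    by (simp add: linear_neg[OF matrix_vector_mul_linear] matrix_vector_right_distrib
        matrix_vector_mult_diff_distrib matrix_vector_mult_diff_rdistrib
        matrix_vector_mul_assoc[symmetric])
  finally show ?thesis .
qed

text \<open>Symmetry of \<open>H\<close> and \<open>M\<close> turns the derivative of K^T into K^T M
  H, which cancels the feedback term; \<open>D\<close> and \<open>G\<close> are built to absorb the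
  contributions of \<open>E\<close> and K \<nu>.\<close>

lemma closed_loop_conserved:
  fixes M :: "real^'n^'n" and E D x :: "real \<Rightarrow> real^'n" and \<nu> :: "real^'n"
  assumes M: "transpose M = M"
    and H_sym: "\<And>t. t \<in> {a..b} \<Longrightarrow> transpose (H t) = H t"
    and K: "solves_on K (\<lambda>t X. H t ** M ** X) a b"
    and G: "solves_on G (\<lambda>t X. transpose (K t) ** M ** K t) a b"
    and D: "solves_on D (\<lambda>t y. (transpose (K t) ** M) *v E t) a b"
    and x: "solves_on x (\<lambda>t y. - (M *v (H t *v y + (E t + K t *v \<nu>)))) a b"
    and st: "s \<in> {a..b}" "t \<in> {a..b}"
  shows "transpose (K s) *v x s + D s + G s *v \<nu> = transpose (K t) *v x t + D t + G t *v \<nu>"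
proof -
  define c where "c t = transpose (K t) *v x t + D t + G t *v \<nu>" for t
  have "(c has_vector_derivative 0) (at t within {a..b})" if t: "t \<in> {a..b}" for t
  proof -
    have "(c has_vector_derivative
        (transpose (K t) *v (- (M *v (H t *v x t + (E t + K t *v \<nu>)))) + transpose (H t ** M ** K t) *v x t)
        + (transpose (K t) ** M) *v E t
        + (G t *v 0 + (transpose (K t) ** M ** K t) *v \<nu>)) (at t within {a..b})"
      unfolding c_def[abs_def]
      by (intro has_vector_derivative_add has_vector_derivative_matrix_vector_mult
          has_vector_derivative_transpose has_vector_derivative_const
          solves_onD[OF K t] solves_onD[OF x t] solves_onD[OF D t] solves_onD[OF G t])
    also have "transpose (H t ** M ** K t) = transpose (K t) ** M ** H t"
      by (simp add: matrix_transpose_mul M H_sym[OF t] matrix_mul_assoc)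
    also have "(transpose (K t) *v (- (M *v (H t *v x t + (E t + K t *v \<nu>)))) + transpose (K t) ** M ** H t *v x t)
        + (transpose (K t) ** M) *v E t
        + (G t *v 0 + (transpose (K t) ** M ** K t) *v \<nu>) = 0"
      by (simp add: linear_neg[OF matrix_vector_mul_linear] matrix_vector_right_distrib
          matrix_vector_mult_diff_distrib matrix_vector_mul_assoc[symmetric] del: transpose_matrix_vector)
    finally show ?thesis .
  qed
  then have "\<exists>k. \<forall>t\<in>{a..b}. c t = k"
    by (intro has_derivative_zero_constant) (auto simp: has_vector_derivative_def)
  then show ?thesis
    using st unfolding c_def by metis
qed

text \<open>The converse of the conservation law: prescribing the conserved value \<xi> and solving
  for the state gives a trajectory. Its derivative comes from differentiating the linear system with
  matrix K^T.\<close>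

lemma closed_loop_solution:
  fixes M :: "real^'n^'n" and E D x :: "real \<Rightarrow> real^'n" and \<nu> \<xi> :: "real^'n"
  assumes "a < b" and M: "transpose M = M"
    and H_sym: "\<And>t. t \<in> {a..b} \<Longrightarrow> transpose (H t) = H t"
    and K: "solves_on K (\<lambda>t X. H t ** M ** X) a b"
    and K_inv: "\<And>t. t \<in> {a..b} \<Longrightarrow> invertible (K t)"
    and G: "solves_on G (\<lambda>t X. transpose (K t) ** M ** K t) a b"
    and D: "solves_on D (\<lambda>t y. (transpose (K t) ** M) *v E t) a b"
    and x: "\<And>t. x t = matrix_inv (transpose (K t)) *v (\<xi> - D t - G t *v \<nu>)"
  shows "solves_on x (\<lambda>t y. - (M *v (H t *v y + (E t + K t *v \<nu>)))) a b"
  unfolding solves_on_def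
proof
  fix t assume t: "t \<in> {a..b}"
  have KT_inv: "invertible (transpose (K t))" if "t \<in> {a..b}" for t
    by (rule transpose_invertible[OF K_inv[OF that]])
  let ?c' = "0 - (transpose (K t) ** M) *v E t - (G t *v 0 + (transpose (K t) ** M ** K t) *v \<nu>)"
  have "((\<lambda>t. \<xi> - D t - G t *v \<nu>) has_vector_derivative ?c') (at t within {a..b})"
    by (intro has_vector_derivative_diff has_vector_derivative_matrix_vector_mult
        has_vector_derivative_const solves_onD[OF D t] solves_onD[OF G t])
  moreover have "transpose (K t) *v x t = \<xi> - D t - G t *v \<nu>" if "t \<in> {a..b}" for t
    unfolding x by (rule matrix_inv_cancel(3)[OF KT_inv[OF that]])
  ultimately have "(x has_vector_derivative matrix_inv (transpose (K t)) *v
      (?c' - transpose (H t ** M ** K t) *v x t)) (at t within {a..b})"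
    by (intro has_vector_derivative_linear_system[OF \<open>a < b\<close>
          has_vector_derivative_transpose[OF solves_onD[OF K t]]] KT_inv t)
  also have "transpose (H t ** M ** K t) = transpose (K t) ** M ** H t"
    by (simp add: matrix_transpose_mul M H_sym[OF t] matrix_mul_assoc)
  \<comment> \<open>Every term carries a left factor K^T, which the inverse then removes.\<close>
  also have "?c' - (transpose (K t) ** M ** H t) *v x t =
      transpose (K t) *v (- (M *v (H t *v x t + (E t + K t *v \<nu>))))"
    by (simp add: linear_neg[OF matrix_vector_mul_linear] matrix_vector_right_distrib
        matrix_vector_mult_diff_distrib matrix_vector_mul_assoc[symmetric] del: transpose_matrix_vector)
  finally show "(x has_vector_derivative - (M *v (H t *v x t + (E t + K t *v \<nu>)))) (at t within {a..b})"
    by (simp only: matrix_inv_cancel(4)[OF KT_inv[OF t]])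
qed

theorem theorem3:
  fixes t0 t1 \<Delta> \<delta> s :: real
    and \<xi>0 \<xi>1 :: "real^2"
    and Q R :: "real^2^2"
    and \<gamma> r :: "real \<Rightarrow> real^2"
    and H K G :: "real \<Rightarrow> real^2^2"
    and E D \<Lambda> :: "real \<Rightarrow> real^2"
    and \<nu> :: "real^2"
    and \<phi> :: "real \<Rightarrow> real"
    and ustar :: "real^2 \<Rightarrow> real \<Rightarrow> real^2"
  assumes "t0 < t1"
    and Q: "sym_pos_def Q" and R: "sym_pos_def R"
    and curve: "regular_curve \<gamma>" "\<Delta> = arclength \<gamma>" "\<Delta> > 0"
      "\<gamma> 0 = \<xi>0" "\<gamma> 1 = \<xi>1"
    and \<delta>: "0 \<le> \<delta>" "\<delta> \<le> \<Delta>" and s: "s = 1 \<or> s = - 1"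
    and r: "\<And>t. r t = \<gamma> (traversal t0 t1 \<Delta> \<delta> s t)"
    and H: "solves_on H (\<lambda>t X. X ** matrix_inv R ** X - Q) t0 t1" "H t1 = 0"
    and K: "solves_on K (\<lambda>t X. H t ** matrix_inv R ** X) t0 t1" "K t1 = mat 1"
    and G: "solves_on G (\<lambda>t X. transpose (K t) ** matrix_inv R ** K t) t0 t1" "G t1 = 0"
    and E: "solves_on E (\<lambda>t y. (H t ** matrix_inv R) *v y + Q *v r t) t0 t1" "E t1 = 0"
    and D: "solves_on D (\<lambda>t y. (transpose (K t) ** matrix_inv R) *v E t) t0 t1" "D t1 = 0"
    and \<nu>: "\<nu> = matrix_inv (G t0) *v (\<xi>1 - transpose (K t0) *v \<xi>0 - D t0)"
    and \<Lambda>: "\<And>t. \<Lambda> t = E t + K t *v \<nu>"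
    and \<phi>: "solves_on \<phi> (\<lambda>t y. 1/2 * (\<Lambda> t \<bullet> (matrix_inv R *v \<Lambda> t)) - 1/2 * (r t \<bullet> (Q *v r t))) t0 t1"
      "\<phi> t1 = - (\<xi>1 \<bullet> \<Lambda> t1)"
    and ustar: "\<And>x t. ustar x t = - (matrix_inv R *v (H t *v x + K t *v \<nu> + E t))"
  shows "invertible (G t0) \<and>
    (\<exists>x. x t0 = \<xi>0 \<and> solves_on x (\<lambda>t y. ustar y t) t0 t1) \<and>
    (\<forall>x. x t0 = \<xi>0 \<and> solves_on x (\<lambda>t y. ustar y t) t0 t1 \<longrightarrow>
      is_minimizer_on (tracking_cost t0 t1 \<xi>0 r Q R) {u. admissible_control t0 t1 \<xi>0 \<xi>1 u}
        (\<lambda>t. ustar (x t) t) \<and>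
      tracking_cost t0 t1 \<xi>0 r Q R (\<lambda>t. ustar (x t) t) =
        \<xi>0 \<bullet> (((1/2) *\<^sub>R H t0 - K t0 ** matrix_inv (G t0) ** transpose (K t0)) *v \<xi>0)
        + \<xi>0 \<bullet> ((K t0 ** matrix_inv (G t0)) *v (\<xi>1 - D t0) + E t0)
        + \<phi> t0)"
proof -
  define M where "M = matrix_inv R"
  have M: "sym_pos_def M" and M_sym: "transpose M = M" and Q_sym: "transpose Q = Q"
    using sym_pos_def_matrix_inv[OF R] Q by (auto simp: M_def sym_pos_def_def)
  note H' = H[folded M_def] and K' = K[folded M_def] and G' = G[folded M_def]
    and E' = E[folded M_def] and D' = D[folded M_def] and \<phi>' = \<phi>[folded M_def]
  have ends: "t0 \<in> {t0..t1}" "t1 \<in> {t0..t1}"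
    using \<open>t0 < t1\<close> by auto
  have r_cont: "continuous_on {t0..t1} r"
    unfolding r[abs_def]
  proof (rule continuous_on_compose2[of "{0..1}" \<gamma> _ "traversal t0 t1 \<Delta> \<delta> s"])
    show "continuous_on {0..1} \<gamma>"
      using curve(1) by (simp add: regular_curve_def)
    show "continuous_on {t0..t1} (traversal t0 t1 \<Delta> \<delta> s)"
      by (rule continuous_on_traversal) fact+
    show "traversal t0 t1 \<Delta> \<delta> s ` {t0..t1} \<subseteq> {0..1}"
      using traversal_mem[OF \<open>t0 < t1\<close> curve(3) \<delta> s] by blast
  qed
  have H_sym: "transpose (H t) = H t" if "t \<in> {t0..t1}" for t
  proof (rule riccati_transpose_eq[OF H'(1) M_sym Q_sym ends(2) _ that])
    show "transpose (H t1) = H t1"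
      unfolding H'(2) by (simp add: transpose_def vec_eq_iff)
  qed
  have K_inv: "invertible (K t)" if "t \<in> {t0..t1}" for t
  proof (rule solves_on_linear_invertible[OF K'(1) _ ends(2) _ that])
    show "continuous_on {t0..t1} (\<lambda>t. H t ** M)"
      by (intro continuous_on_matrix_mult continuous_on_const solves_on_continuous_on[OF H'(1)])
    show "invertible (K t1)"
      by (simp add: K'(2) invertible_def exI[of _ "mat 1"])
  qed
  have G_inv: "invertible (G t0)"
    by (rule gramian_invertible[OF \<open>t0 < t1\<close> M G' K_inv[OF ends(2)]])
  \<comment> \<open>Invertibility of \<open>G t0\<close> makes \<nu> the multiplier for which the
    conserved quantity at \<open>t0\<close> equals \<xi>1.\<close>
  have G\<nu>: "G t0 *v \<nu> = \<xi>1 - transpose (K t0) *v \<xi>0 - D t0"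
    unfolding \<nu> by (rule matrix_inv_cancel(3)[OF G_inv])
  \<comment> \<open>\<open>E\<close> is a particular solution of this inhomogeneous equation and K
    \<nu> a solution of the homogeneous one.\<close>
  have \<Lambda>_solves: "solves_on \<Lambda> (\<lambda>t y. (H t ** M) *v y + Q *v r t) t0 t1"
    unfolding solves_on_def
  proof
    fix t assume t: "t \<in> {t0..t1}"
    have "(\<Lambda> has_vector_derivative
        ((H t ** M) *v E t + Q *v r t) + (K t *v 0 + (H t ** M ** K t) *v \<nu>)) (at t within {t0..t1})"
      unfolding \<Lambda>[abs_def]
      by (intro has_vector_derivative_add has_vector_derivative_matrix_vector_mult
          has_vector_derivative_const solves_onD[OF E'(1) t] solves_onD[OF K'(1) t])
    then show "(\<Lambda> has_vector_derivative (H t ** M) *v \<Lambda> t + Q *v r t) (at t within {t0..t1})"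
      by (simp add: \<Lambda> matrix_vector_right_distrib matrix_vector_mul_assoc algebra_simps)
  qed
  have ustar_eq: "ustar y t = - (M *v (H t *v y + \<Lambda> t))" for y t
    by (simp add: ustar M_def \<Lambda> algebra_simps)

  \<comment> \<open>The conservation law with value \<xi>1, solved for the state. At
    \<open>t0\<close> the choice of \<nu> reduces the bracket to K^T \<xi>0, which gives the initial
    value.\<close>
  define x\<^sub>K where "x\<^sub>K t = matrix_inv (transpose (K t)) *v (\<xi>1 - D t - G t *v \<nu>)" for t
  have "x\<^sub>K t0 = \<xi>0"
    using matrix_inv_cancel(4)[OF transpose_invertible[OF K_inv[OF ends(1)]], of \<xi>0]
    by (simp add: x\<^sub>K_def G\<nu>)
  moreover have "solves_on x\<^sub>K (\<lambda>t y. ustar y t) t0 t1"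
    unfolding ustar_eq \<Lambda>
    by (rule closed_loop_solution[OF \<open>t0 < t1\<close> M_sym H_sym K'(1) K_inv G'(1) D'(1) x\<^sub>K_def])
  ultimately have ex: "\<exists>x. x t0 = \<xi>0 \<and> solves_on x (\<lambda>t y. ustar y t) t0 t1"
    by blast

  have "is_minimizer_on (tracking_cost t0 t1 \<xi>0 r Q R) {u. admissible_control t0 t1 \<xi>0 \<xi>1 u}
        (\<lambda>t. ustar (x t) t)"
    and "tracking_cost t0 t1 \<xi>0 r Q R (\<lambda>t. ustar (x t) t) =
        \<xi>0 \<bullet> (((1/2) *\<^sub>R H t0 - K t0 ** matrix_inv (G t0) ** transpose (K t0)) *v \<xi>0)
        + \<xi>0 \<bullet> ((K t0 ** matrix_inv (G t0)) *v (\<xi>1 - D t0) + E t0)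
        + \<phi> t0" (is "?cost = ?value")
    if x0: "x t0 = \<xi>0" and x: "solves_on x (\<lambda>t y. ustar y t) t0 t1" for x
  proof -
    note x' = x[unfolded ustar_eq]
    \<comment> \<open>At \<open>t1\<close> the conserved quantity is the state itself, as K = I and
      D = G = 0 there; at \<open>t0\<close> it is \<xi>1 by the choice of \<nu>.\<close>
    have x1: "x t1 = \<xi>1"
      using closed_loop_conserved[OF M_sym H_sym K'(1) G'(1) D'(1) x'[unfolded \<Lambda>] ends(2) ends(1)]
      by (simp add: K'(2) D'(2) G'(2) x0 G\<nu> transpose_mat)
    have u_cont: "continuous_on {t0..t1} (\<lambda>t. ustar (x t) t)"
      unfolding ustar_eq
      by (intro continuous_intros continuous_on_matrix_vector_mult solves_on_continuous_on[OF H'(1)]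
          solves_on_continuous_on[OF \<Lambda>_solves] solves_on_continuous_on[OF x])
    have Ru: "R *v ustar (x t) t = - (H t *v x t + \<Lambda> t)" for t
      using matrix_inv_cancel(3)[OF sym_pos_def_invertible[OF R]]
      by (simp add: ustar_eq M_def linear_neg[OF matrix_vector_mul_linear])
    show "is_minimizer_on (tracking_cost t0 t1 \<xi>0 r Q R) {u. admissible_control t0 t1 \<xi>0 \<xi>1 u}
        (\<lambda>t. ustar (x t) t)"
      using costate_imp_minimizer[OF less_imp_le[OF \<open>t0 < t1\<close>] Q R r_cont solves_onD[OF x] u_cont
          costate_has_vector_derivative[OF H'(1) \<Lambda>_solves x'] Ru]
      by (simp only: x0 x1)
    have "?cost = (1/2 * (\<xi>0 \<bullet> (H t0 *v \<xi>0)) + \<xi>0 \<bullet> \<Lambda> t0 + \<phi> t0)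
        - (1/2 * (\<xi>1 \<bullet> (H t1 *v \<xi>1)) + \<xi>1 \<bullet> \<Lambda> t1 + \<phi> t1)"
      using tracking_cost_feedback[OF less_imp_le[OF \<open>t0 < t1\<close>] R Q_sym r_cont H(1) H_sym
          \<Lambda>_solves[unfolded M_def] \<phi>(1) x'[unfolded M_def] ustar_eq[unfolded M_def]]
      by (simp only: x0 x1)
    \<comment> \<open>The value function at \<open>t1\<close> vanishes on \<xi>1, because H = 0
      there and \<phi> was given the opposite of the linear term. At \<open>t0\<close>, inserting
      \<nu> into \<xi>0 \<bullet> \<Lambda> produces the K G^-1 K^T term, hence its coefficient 1
      rather than 1/2.\<close>
    also have "\<dots> = ?value"
      by (simp add: H'(2) \<phi>(2) \<Lambda> \<nu> matrix_vector_mult_diff_rdistrib matrix_vector_mult_diff_distrib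
          inner_add_right inner_diff_right scaleR_matrix_vector_assoc[symmetric]
          matrix_vector_mul_assoc[symmetric] del: transpose_matrix_vector)
    finally show "?cost = ?value" .
  qed
  with G_inv ex show ?thesis
    by blast
qed

end
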